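(* Let $\mathcal{G}$ be a finite groupoid, $K$ a field, and $\mathcal{A}$ a $K$-algebra. Let $\pi : \mathcal{G} \to \mathcal{A}$ be a partial groupoid representation of $\mathcal{G}$ on $\mathcal{A}$. Then there exists a unique homomorphism of $K$-algebras $\phi : K_{\text{par}}(\mathcal{G}) \to \mathcal{A}$ such that $\phi([g]) = \pi(g)$ for all $g \in \mathcal{G}$. Conversely, if $\phi : K_{\text{par}}(\mathcal{G}) \to \mathcal{A}$ is a homomorphism of $K$-algebras, then $\pi(g) = \phi([g])$, $g \in \mathcal{G}$, defines a partial groupoid representation of $\mathcal{G}$ on $\mathcal{A}$.
   Context: A groupoid $\mathcal{G}$ is a small category in which every morphism is an isomorphism; it is identified with its set of morphisms, and its set of objects $\mathcal{G}_0$ is regarded as a subset of $\mathcal{G}$ via identity morphisms. For $g \in \mathcal{G}$, the domain and range are $d(g) = g^{-1}g$ and $r(g) = gg^{-1}$ (elements of $\mathcal{G}_0$). The product $gh$ is defined exactly when $d(g) = r(h)$, and $\mathcal{G}_2 = \{(g,h) \in \mathcal{G}\times\mathcal{G} : gh \text{ is defined}\}$. All algebras are associative and unital, and homomorphisms of $K$-algebras preserve the unit. A partial groupoid representation of $\mathcal{G}$ on a $K$-algebra $\mathcal{A}$ is a map $\pi : \mathcal{G} \to \mathcal{A}$ such that: (i) $\pi(g)\pi(h)\pi(h^{-1}) = \pi(gh)\pi(h^{-1})$ for all $(g,h) \in \mathcal{G}_2$; (ii) $\pi(g^{-1})\pi(g)\pi(h) = \pi(g^{-1})\pi(gh)$ for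 all $(g,h) \in \mathcal{G}_2$; (iii) $\pi(g)\pi(g^{-1})\pi(g) = \pi(g)$ for all $g \in \mathcal{G}$; (iv) $\sum_{e \in \mathcal{G}_0} \pi(e) = 1_{\mathcal{A}}$, and $\pi(e)\pi(f) = 0$ for all $e,f \in \mathcal{G}_0$ with $e \neq f$. The partial groupoid algebra $K_{\text{par}}(\mathcal{G})$ is the universal $K$-algebra with unit generated by the set of symbols $\{[g] : g \in \mathcal{G}\}$ subject to the relations: (i) $[g^{-1}][g][h] = [g^{-1}][gh]$ for all $(g,h) \in \mathcal{G}_2$; (ii) $[g][h][h^{-1}] = [gh][h^{-1}]$ for all $(g,h) \in \mathcal{G}_2$; (iii) $[r(g)][g] = [g] = [g][d(g)]$ for all $g \in \mathcal{G}$; (iv) $[g][h] = 0$ for all $(g,h) \in (\mathcal{G}\times\mathcal{G}) \setminus \mathcal{G}_2$; its unit is $1_{K_{\text{par}}(\mathcal{G})} = \sum_{e \in \mathcal{G}_0}[e]$. (That is, $K_{\text{par}}(\mathcal{G})$ is the quotient of the free unital associative $K$-algebra on the symbols $[g]$ by the relations (i)--(iv) together with $\sum_{e \in \mathcal{G}_0}[e] = 1$.) *)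

theory Defs
  imports "HOL-Algebra.Module" "HOL-Algebra.QuotRing"
begin

section \<open>Groupoids\<close>

text \<open>
  Small categories are presented in one-sorted form: the carrier is the set of morphisms, an object
  is the same thing as its identity morphism, and the domain and range of a morphism are
  (identity) morphisms. The value \<^term>\<open>gcomp G g h\<close> is meaningful only if
  \<^term>\<open>gdom G g = grng G h\<close> (first \<^term>\<open>h\<close>, then \<^term>\<open>g\<close>).
\<close>

record 'g arrows = "'g partial_object" +
  gdom :: "'g \<Rightarrow> 'g"
  grng :: "'g \<Rightarrow> 'g"
  gcomp :: "'g \<Rightarrow> 'g \<Rightarrow> 'g"

definition objects :: "('g, 'm) arrows_scheme \<Rightarrow> 'g set"
  where "objects G = {e \<in> carrier G. gdom G e = e}"

definition composable :: "('g, 'm) arrows_scheme \<Rightarrow> ('g \<times> 'g) set"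
  where "composable G = {(g, h). g \<in> carrier G \<and> h \<in> carrier G \<and> gdom G g = grng G h}"

locale small_category =
  fixes G :: "('g, 'm) arrows_scheme"
  assumes gdom_closed: "g \<in> carrier G \<Longrightarrow> gdom G g \<in> carrier G"
    and grng_closed: "g \<in> carrier G \<Longrightarrow> grng G g \<in> carrier G"
    and gdom_gdom: "g \<in> carrier G \<Longrightarrow> gdom G (gdom G g) = gdom G g"
    and grng_gdom: "g \<in> carrier G \<Longrightarrow> grng G (gdom G g) = gdom G g"
    and gdom_grng: "g \<in> carrier G \<Longrightarrow> gdom G (grng G g) = grng G g"
    and grng_grng: "g \<in> carrier G \<Longrightarrow> grng G (grng G g) = grng G g"
    and gcomp_closed: "(g, h) \<in> composable G \<Longrightarrow> gcomp G g h \<in> carrier G"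
    and gdom_gcomp: "(g, h) \<in> composable G \<Longrightarrow> gdom G (gcomp G g h) = gdom G h"
    and grng_gcomp: "(g, h) \<in> composable G \<Longrightarrow> grng G (gcomp G g h) = grng G g"
    and gcomp_gdom: "g \<in> carrier G \<Longrightarrow> gcomp G g (gdom G g) = g"
    and grng_gcomp_self: "g \<in> carrier G \<Longrightarrow> gcomp G (grng G g) g = g"
    and gcomp_assoc: "(g, h) \<in> composable G \<Longrightarrow> (h, k) \<in> composable G \<Longrightarrow>
      gcomp G (gcomp G g h) k = gcomp G g (gcomp G h k)"

definition is_ginv :: "('g, 'm) arrows_scheme \<Rightarrow> 'g \<Rightarrow> 'g \<Rightarrow> bool"
  where "is_ginv G g h \<longleftrightarrow> (g, h) \<in> composable G \<and> (h, g) \<in> composable G \<and>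
    gcomp G h g = gdom G g \<and> gcomp G g h = grng G g"

definition ginv :: "('g, 'm) arrows_scheme \<Rightarrow> 'g \<Rightarrow> 'g"
  where "ginv G g = (THE h. is_ginv G g h)"

locale groupoid = small_category +
  assumes all_iso: "g \<in> carrier G \<Longrightarrow> \<exists>h. is_ginv G g h"
begin

lemma is_ginv_unique:
  assumes "is_ginv G g h" "is_ginv G g k"
  shows "h = k"
proof -
  from assms have m: "h \<in> carrier G" "k \<in> carrier G" "(h, g) \<in> composable G" "(g, k) \<in> composable G"
    and e: "gcomp G h g = gdom G g" "gcomp G g k = grng G g" "gdom G g = grng G k" "gdom G h = grng G g"
    by (auto simp: is_ginv_def composable_def)
  have "h = gcomp G h (gcomp G g k)" using e gcomp_gdom[OF m(1)] by simp
  also have "\<dots> = gcomp G (gcomp G h g) k" using gcomp_assoc[OF m(3,4)] by simp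
  also have "\<dots> = k" using e grng_gcomp_self[OF m(2)] by simp
  finally show ?thesis .
qed

lemma is_ginv_ginv: "g \<in> carrier G \<Longrightarrow> is_ginv G g (ginv G g)"
  unfolding ginv_def using all_iso is_ginv_unique by (metis theI)

lemma ginv_closed: "g \<in> carrier G \<Longrightarrow> ginv G g \<in> carrier G"
  using is_ginv_ginv by (auto simp: is_ginv_def composable_def)

lemma gdom_eq: "g \<in> carrier G \<Longrightarrow> gdom G g = gcomp G (ginv G g) g"
  and grng_eq: "g \<in> carrier G \<Longrightarrow> grng G g = gcomp G g (ginv G g)"
  using is_ginv_ginv by (auto simp: is_ginv_def)

end


section \<open>Unital associative algebras\<close>

text \<open>
  The library locale \<^locale>\<open>algebra\<close> covers commutative algebras only.
\<close>

locale unital_algebra = K?: field K + A: ring A + module K A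
  for K (structure) and A (structure) +
  assumes smult_mult_left: "\<lbrakk>c \<in> carrier K; x \<in> carrier A; y \<in> carrier A\<rbrakk> \<Longrightarrow>
      (c \<odot>\<^bsub>A\<^esub> x) \<otimes>\<^bsub>A\<^esub> y = c \<odot>\<^bsub>A\<^esub> (x \<otimes>\<^bsub>A\<^esub> y)"
    and smult_mult_right: "\<lbrakk>c \<in> carrier K; x \<in> carrier A; y \<in> carrier A\<rbrakk> \<Longrightarrow>
      x \<otimes>\<^bsub>A\<^esub> (c \<odot>\<^bsub>A\<^esub> y) = c \<odot>\<^bsub>A\<^esub> (x \<otimes>\<^bsub>A\<^esub> y)"

text \<open>
  Unit preservation is part of \<^const>\<open>ring_hom\<close>.
\<close>

definition algebra_hom ::
    "('k, 'n) ring_scheme \<Rightarrow> ('k, 'a, 'p) module_scheme \<Rightarrow> ('k, 'b, 'q) module_scheme \<Rightarrow> ('a \<Rightarrow> 'b) set"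
  where "algebra_hom K A B = {\<phi> \<in> ring_hom A B.
    \<forall>c\<in>carrier K. \<forall>x\<in>carrier A. \<phi> (c \<odot>\<^bsub>A\<^esub> x) = c \<odot>\<^bsub>B\<^esub> \<phi> x}"

text \<open>
  Noncommutative polynomials over \<^term>\<open>K\<close> in the variables \<^term>\<open>X\<close>: finitely supported
  functions from the words over \<^term>\<open>X\<close> to \<^term>\<open>K\<close>, extended by zero to all lists. The
  coefficient of a product at \<^term>\<open>w\<close> is the sum over all ways to cut \<^term>\<open>w\<close> in two.
\<close>

definition free_algebra :: "('k, 'n) ring_scheme \<Rightarrow> 'x set \<Rightarrow> ('k, 'x list \<Rightarrow> 'k) module"
  where "free_algebra K X =
    \<lparr>carrier = {p. range p \<subseteq> carrier K \<and> finite {w. p w \<noteq> \<zero>\<^bsub>K\<^esub>} \<and> {w. p w \<noteq> \<zero>\<^bsub>K\<^esub>} \<subseteq> lists X},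
     mult = (\<lambda>p q w. \<Oplus>\<^bsub>K\<^esub>i\<in>{..length w}. p (take i w) \<otimes>\<^bsub>K\<^esub> q (drop i w)),
     one = (\<lambda>w. if w = [] then \<one>\<^bsub>K\<^esub> else \<zero>\<^bsub>K\<^esub>),
     zero = (\<lambda>w. \<zero>\<^bsub>K\<^esub>),
     add = (\<lambda>p q w. p w \<oplus>\<^bsub>K\<^esub> q w),
     smult = (\<lambda>c p w. c \<otimes>\<^bsub>K\<^esub> p w)\<rparr>"

definition free_gen :: "('k, 'n) ring_scheme \<Rightarrow> 'x \<Rightarrow> 'x list \<Rightarrow> 'k"
  where "free_gen K x = (\<lambda>w. if w = [x] then \<one>\<^bsub>K\<^esub> else \<zero>\<^bsub>K\<^esub>)"

text \<open>
  A two-sided ideal of a unital algebra is automatically closed under scalars, so the ring quotient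
  inherits a scalar multiplication, written here like \<^const>\<open>rcoset_mult\<close>.
\<close>

definition quotient_algebra :: "('k, 'a, 'p) module_scheme \<Rightarrow> 'a set \<Rightarrow> ('k, 'a set) module"
  where "quotient_algebra A I =
    \<lparr>carrier = carrier (A Quot I), mult = mult (A Quot I), one = one (A Quot I),
     zero = zero (A Quot I), add = add (A Quot I),
     smult = (\<lambda>c S. \<Union>x\<in>S. I +>\<^bsub>A\<^esub> (c \<odot>\<^bsub>A\<^esub> x))\<rparr>"


section \<open>Partial groupoid representations and the partial groupoid algebra\<close>

definition partial_rep :: "('g, 'm) arrows_scheme \<Rightarrow> ('a, 'p) ring_scheme \<Rightarrow> ('g \<Rightarrow> 'a) \<Rightarrow> bool"
  where "partial_rep G A \<pi> \<longleftrightarrow>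
    \<pi> \<in> carrier G \<rightarrow> carrier A \<and>
    (\<forall>(g, h) \<in> composable G.
      \<pi> g \<otimes>\<^bsub>A\<^esub> \<pi> h \<otimes>\<^bsub>A\<^esub> \<pi> (ginv G h) = \<pi> (gcomp G g h) \<otimes>\<^bsub>A\<^esub> \<pi> (ginv G h)) \<and>
    (\<forall>(g, h) \<in> composable G.
      \<pi> (ginv G g) \<otimes>\<^bsub>A\<^esub> \<pi> g \<otimes>\<^bsub>A\<^esub> \<pi> h = \<pi> (ginv G g) \<otimes>\<^bsub>A\<^esub> \<pi> (gcomp G g h)) \<and>
    (\<forall>g \<in> carrier G. \<pi> g \<otimes>\<^bsub>A\<^esub> \<pi> (ginv G g) \<otimes>\<^bsub>A\<^esub> \<pi> g = \<pi> g) \<and>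
    (\<Oplus>\<^bsub>A\<^esub>e\<in>objects G. \<pi> e) = \<one>\<^bsub>A\<^esub> \<and>
    (\<forall>e \<in> objects G. \<forall>f \<in> objects G. e \<noteq> f \<longrightarrow> \<pi> e \<otimes>\<^bsub>A\<^esub> \<pi> f = \<zero>\<^bsub>A\<^esub>)"

text \<open>
  Each relation \<open>a = b\<close> is represented by the element \<open>a - b\<close> of the free algebra on the morphisms.
\<close>

definition par_relators :: "('k, 'n) ring_scheme \<Rightarrow> ('g, 'm) arrows_scheme \<Rightarrow> ('g list \<Rightarrow> 'k) set"
  where "par_relators K G = (let F = free_algebra K (carrier G); x = free_gen K in
    {x (ginv G g) \<otimes>\<^bsub>F\<^esub> x g \<otimes>\<^bsub>F\<^esub> x h \<ominus>\<^bsub>F\<^esub> x (ginv G g) \<otimes>\<^bsub>F\<^esub> x (gcomp G g h)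
      | g h. (g, h) \<in> composable G} \<union>
    {x g \<otimes>\<^bsub>F\<^esub> x h \<otimes>\<^bsub>F\<^esub> x (ginv G h) \<ominus>\<^bsub>F\<^esub> x (gcomp G g h) \<otimes>\<^bsub>F\<^esub> x (ginv G h)
      | g h. (g, h) \<in> composable G} \<union>
    {x (grng G g) \<otimes>\<^bsub>F\<^esub> x g \<ominus>\<^bsub>F\<^esub> x g | g. g \<in> carrier G} \<union>
    {x g \<otimes>\<^bsub>F\<^esub> x (gdom G g) \<ominus>\<^bsub>F\<^esub> x g | g. g \<in> carrier G} \<union>
    {x g \<otimes>\<^bsub>F\<^esub> x h | g h. (g, h) \<in> (carrier G \<times> carrier G) - composable G} \<union>
    {(\<Oplus>\<^bsub>F\<^esub>e\<in>objects G. x e) \<ominus>\<^bsub>F\<^esub> \<one>\<^bsub>F\<^esub>})"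

definition par_ideal :: "('k, 'n) ring_scheme \<Rightarrow> ('g, 'm) arrows_scheme \<Rightarrow> ('g list \<Rightarrow> 'k) set"
  where "par_ideal K G = Idl\<^bsub>free_algebra K (carrier G)\<^esub> (par_relators K G)"

definition par_algebra ::
    "('k, 'n) ring_scheme \<Rightarrow> ('g, 'm) arrows_scheme \<Rightarrow> ('k, ('g list \<Rightarrow> 'k) set) module"
  where "par_algebra K G = quotient_algebra (free_algebra K (carrier G)) (par_ideal K G)"

definition par_gen :: "('k, 'n) ring_scheme \<Rightarrow> ('g, 'm) arrows_scheme \<Rightarrow> 'g \<Rightarrow> ('g list \<Rightarrow> 'k) set"
  where "par_gen K G g = par_ideal K G +>\<^bsub>free_algebra K (carrier G)\<^esub> free_gen K g"

section \<open>The partial groupoid algebra is a unital algebra\<close>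

lemma (in abelian_monoid) finsum_triangle:
  assumes "\<And>j i. h j i \<in> carrier G"
  shows "(\<Oplus>i\<in>{..n::nat}. \<Oplus>j\<in>{..i}. h j i) = (\<Oplus>j\<in>{..n}. \<Oplus>k\<in>{..n-j}. h j (j+k))"
proof (induction n)
  case 0 show ?case using assms by simp
next
  case (Suc n)
  have "(\<Oplus>j\<in>{..n}. \<Oplus>k\<in>{..Suc n-j}. h j (j+k)) = (\<Oplus>j\<in>{..n}. h j (Suc n) \<oplus> (\<Oplus>k\<in>{..n-j}. h j (j+k)))"
    by (rule finsum_cong') (auto simp: Suc_diff_le assms)
  also have "\<dots> = (\<Oplus>j\<in>{..n}. h j (Suc n)) \<oplus> (\<Oplus>j\<in>{..n}. \<Oplus>k\<in>{..n-j}. h j (j+k))"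
    by (rule finsum_addf) (auto simp: assms)
  finally show ?case using Suc by (simp add: assms a_ac)
qed

locale free_algebra_over_field = field K for K :: "('k, 'n) ring_scheme" (structure) +
  fixes X :: "'x set"
begin

abbreviation "F \<equiv> free_algebra K X"

lemma free_sel: "p \<otimes>\<^bsub>F\<^esub> q = (\<lambda>w. \<Oplus>i\<in>{..length w}. p (take i w) \<otimes> q (drop i w))"
  "p \<oplus>\<^bsub>F\<^esub> q = (\<lambda>w. p w \<oplus> q w)" "c \<odot>\<^bsub>F\<^esub> p = (\<lambda>w. c \<otimes> p w)" "\<zero>\<^bsub>F\<^esub> = (\<lambda>w. \<zero>)"
  "\<one>\<^bsub>F\<^esub> = (\<lambda>w. if w = [] then \<one> else \<zero>)"
  by (simp_all add: free_algebra_def)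

lemma free_coeff: "p \<in> carrier F \<Longrightarrow> p w \<in> carrier K"
  by (auto simp: free_algebra_def)

lemma free_mem_iff: "p \<in> carrier F \<longleftrightarrow> (\<forall>w. p w \<in> carrier K) \<and> (\<exists>S. finite S \<and> S \<subseteq> lists X \<and> (\<forall>w. w \<notin> S \<longrightarrow> p w = \<zero>))"
  (is "_ \<longleftrightarrow> ?R")
proof
  assume "p \<in> carrier F" then show ?R unfolding free_algebra_def
    by (auto intro!: exI[of _ "{w. p w \<noteq> \<zero>}"])
next
  assume ?R then obtain S where S: "finite S" "S \<subseteq> lists X" "\<forall>w. w \<notin> S \<longrightarrow> p w = \<zero>" and c: "\<forall>w. p w \<in> carrier K" by blast
  then have "{w. p w \<noteq> \<zero>} \<subseteq> S" by blast
  with S c show "p \<in> carrier F" unfolding free_algebra_def by (auto intro: finite_subset)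
qed

lemma free_mult_closed: assumes "p \<in> carrier F" "q \<in> carrier F" shows "p \<otimes>\<^bsub>F\<^esub> q \<in> carrier F"
proof -
  from assms obtain S T where S: "finite S" "S \<subseteq> lists X" "\<forall>w. w \<notin> S \<longrightarrow> p w = \<zero>"
    and T: "finite T" "T \<subseteq> lists X" "\<forall>w. w \<notin> T \<longrightarrow> q w = \<zero>" unfolding free_mem_iff by blast
  let ?U = "(\<lambda>(a,b). a @ b) ` (S \<times> T)"
  have "(p \<otimes>\<^bsub>F\<^esub> q) w = \<zero>" if w: "w \<notin> ?U" for w
  proof -
    have "take i w \<notin> S \<or> drop i w \<notin> T" for i
    proof (rule ccontr)
      assume "\<not> ?thesis"
      then have "(take i w, drop i w) \<in> S \<times> T" by simp
      then have "take i w @ drop i w \<in> ?U" by (rule rev_image_eqI) simp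
      with w show False by simp
    qed
    then have "p (take i w) \<otimes> q (drop i w) = \<zero>" for i using S(3) T(3) free_coeff[OF assms(1)] free_coeff[OF assms(2)] by (metis l_null r_null)
    then show ?thesis by (simp add: free_sel)
  qed
  moreover have "finite ?U" using S T by auto
  moreover have "?U \<subseteq> lists X" using S(2) T(2) by (auto simp only: subset_iff image_iff in_lists_conv_set set_append Un_iff split: prod.splits)
  moreover have "(p \<otimes>\<^bsub>F\<^esub> q) w \<in> carrier K" for w using assms free_coeff by (auto simp: free_sel intro!: finsum_closed)
  ultimately show ?thesis unfolding free_mem_iff by blast
qed

lemma free_add_closed: assumes "p \<in> carrier F" "q \<in> carrier F" shows "p \<oplus>\<^bsub>F\<^esub> q \<in> carrier F"
proof -
  from assms obtain S T where S: "finite S" "S \<subseteq> lists X" "\<forall>w. w \<notin> S \<longrightarrow> p w = \<zero>"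
    and T: "finite T" "T \<subseteq> lists X" "\<forall>w. w \<notin> T \<longrightarrow> q w = \<zero>" unfolding free_mem_iff by blast
  then show ?thesis unfolding free_mem_iff using assms by (auto simp: free_sel free_coeff intro!: exI[of _ "S \<union> T"])
qed

lemma free_smult_closed: assumes "c \<in> carrier K" "q \<in> carrier F" shows "c \<odot>\<^bsub>F\<^esub> q \<in> carrier F"
proof -
  from assms obtain T where
    T: "finite T" "T \<subseteq> lists X" "\<forall>w. w \<notin> T \<longrightarrow> q w = \<zero>" unfolding free_mem_iff by blast
  then show ?thesis unfolding free_mem_iff using assms by (auto simp: free_sel free_coeff intro!: exI[of _ "T"])
qed

lemma free_is_ring: "ring F"
proof (rule ringI)
  show "abelian_group F"
  proof (rule abelian_groupI)
    show "\<zero>\<^bsub>F\<^esub> \<in> carrier F" unfolding free_mem_iff free_sel by auto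
    fix x assume x: "x \<in> carrier F"
    show "\<exists>y\<in>carrier F. y \<oplus>\<^bsub>F\<^esub> x = \<zero>\<^bsub>F\<^esub>"
    proof (rule bexI)
      show "((\<ominus> \<one>) \<odot>\<^bsub>F\<^esub> x) \<oplus>\<^bsub>F\<^esub> x = \<zero>\<^bsub>F\<^esub>" using free_coeff[OF x] by (auto simp: free_sel l_minus l_neg)
    qed (rule free_smult_closed, use x in auto)
  next
    fix x y assume "x \<in> carrier F" "y \<in> carrier F"
    then show "x \<oplus>\<^bsub>F\<^esub> y \<in> carrier F" by (rule free_add_closed)
  next
    fix x y z assume "x \<in> carrier F" "y \<in> carrier F" "z \<in> carrier F"
    from this[THEN free_coeff] show "x \<oplus>\<^bsub>F\<^esub> y \<oplus>\<^bsub>F\<^esub> z = x \<oplus>\<^bsub>F\<^esub> (y \<oplus>\<^bsub>F\<^esub> z)" by (simp add: free_sel a_assoc)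
  next
    fix x y assume "x \<in> carrier F" "y \<in> carrier F"
    from this[THEN free_coeff] show "x \<oplus>\<^bsub>F\<^esub> y = y \<oplus>\<^bsub>F\<^esub> x" by (simp add: free_sel a_comm)
  next
    fix x assume "x \<in> carrier F"
    from this[THEN free_coeff] show "\<zero>\<^bsub>F\<^esub> \<oplus>\<^bsub>F\<^esub> x = x" by (simp add: free_sel)
  qed
  show "Group.monoid F"
  proof (rule monoidI)
    show "\<one>\<^bsub>F\<^esub> \<in> carrier F" unfolding free_mem_iff free_sel by (auto intro!: exI[of _ "{[]}"])
  next
    fix x y z assume xyz: "x \<in> carrier F" "y \<in> carrier F" "z \<in> carrier F"
    show "x \<otimes>\<^bsub>F\<^esub> y \<otimes>\<^bsub>F\<^esub> z = x \<otimes>\<^bsub>F\<^esub> (y \<otimes>\<^bsub>F\<^esub> z)"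
    proof
      fix w
      let ?h = "\<lambda>j i. x (take j w) \<otimes> (y (drop j (take i w)) \<otimes> z (drop i w))"
      have "(x \<otimes>\<^bsub>F\<^esub> y \<otimes>\<^bsub>F\<^esub> z) w = (\<Oplus>i\<in>{..length w}. \<Oplus>j\<in>{..i}. ?h j i)"
        unfolding free_sel using xyz
        by (auto simp: free_coeff finsum_ldistr m_assoc min_absorb1 min_absorb2 intro!: finsum_cong' finsum_closed)
      also have "\<dots> = (\<Oplus>j\<in>{..length w}. \<Oplus>k\<in>{..length w-j}. ?h j (j+k))"
        by (rule finsum_triangle) (use xyz free_coeff in auto)
      also have "\<dots> = (x \<otimes>\<^bsub>F\<^esub> (y \<otimes>\<^bsub>F\<^esub> z)) w"
        unfolding free_sel using xyz
        by (auto simp: free_coeff finsum_rdistr take_drop drop_drop add.commute intro!: finsum_cong' finsum_closed)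
      finally show "(x \<otimes>\<^bsub>F\<^esub> y \<otimes>\<^bsub>F\<^esub> z) w = (x \<otimes>\<^bsub>F\<^esub> (y \<otimes>\<^bsub>F\<^esub> z)) w" .
    qed
  next
    fix x assume x: "x \<in> carrier F"
    show "\<one>\<^bsub>F\<^esub> \<otimes>\<^bsub>F\<^esub> x = x"
    proof
      fix w
      have "(\<one>\<^bsub>F\<^esub> \<otimes>\<^bsub>F\<^esub> x) w = (\<Oplus>i\<in>{..length w}. if 0 = i then x (drop i w) else \<zero>)"
        unfolding free_sel using free_coeff[OF x] by (intro finsum_cong') auto
      also have "\<dots> = x w" using add.finprod_singleton[of 0 "{..length w}" "\<lambda>i. x (drop i w)"] free_coeff[OF x] by auto
      finally show "(\<one>\<^bsub>F\<^esub> \<otimes>\<^bsub>F\<^esub> x) w = x w" .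
    qed
    show "x \<otimes>\<^bsub>F\<^esub> \<one>\<^bsub>F\<^esub> = x"
    proof
      fix w
      have "(x \<otimes>\<^bsub>F\<^esub> \<one>\<^bsub>F\<^esub>) w = (\<Oplus>i\<in>{..length w}. if length w = i then x (take i w) else \<zero>)"
        unfolding free_sel using free_coeff[OF x] by (intro finsum_cong') auto
      also have "\<dots> = x w" using add.finprod_singleton[of "length w" "{..length w}" "\<lambda>i. x (take i w)"] free_coeff[OF x] by auto
      finally show "(x \<otimes>\<^bsub>F\<^esub> \<one>\<^bsub>F\<^esub>) w = x w" .
    qed
  qed (rule free_mult_closed)
next
  fix x y z assume xyz: "x \<in> carrier F" "y \<in> carrier F" "z \<in> carrier F"
  show "(x \<oplus>\<^bsub>F\<^esub> y) \<otimes>\<^bsub>F\<^esub> z = x \<otimes>\<^bsub>F\<^esub> z \<oplus>\<^bsub>F\<^esub> y \<otimes>\<^bsub>F\<^esub> z"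
    unfolding free_sel using xyz apply (intro ext, subst finsum_addf[symmetric]) by (auto simp: free_coeff l_distr Pi_def intro!: finsum_cong')
  show "z \<otimes>\<^bsub>F\<^esub> (x \<oplus>\<^bsub>F\<^esub> y) = z \<otimes>\<^bsub>F\<^esub> x \<oplus>\<^bsub>F\<^esub> z \<otimes>\<^bsub>F\<^esub> y"
    unfolding free_sel using xyz apply (intro ext, subst finsum_addf[symmetric]) by (auto simp: free_coeff r_distr Pi_def intro!: finsum_cong')
qed

lemma free_is_unital_algebra: "unital_algebra K F"
proof -
  interpret F: ring F by (rule free_is_ring)
  interpret module K F
    by (rule moduleI) (use F.abelian_group_axioms free_smult_closed in \<open>auto simp: is_cring free_sel free_coeff l_distr r_distr m_assoc\<close>)
  show ?thesis
  proof
    fix c x y assume *: "c \<in> carrier K" "x \<in> carrier F" "y \<in> carrier F"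
    show "c \<odot>\<^bsub>F\<^esub> x \<otimes>\<^bsub>F\<^esub> y = c \<odot>\<^bsub>F\<^esub> (x \<otimes>\<^bsub>F\<^esub> y)"
      unfolding free_sel using * by (auto simp: free_coeff finsum_rdistr m_assoc Pi_def intro!: finsum_cong')
    show "x \<otimes>\<^bsub>F\<^esub> (c \<odot>\<^bsub>F\<^esub> y) = c \<odot>\<^bsub>F\<^esub> (x \<otimes>\<^bsub>F\<^esub> y)"
      unfolding free_sel using * by (auto simp: free_coeff finsum_rdistr m_lcomm Pi_def intro!: finsum_cong')
  qed
qed
lemma free_gen_closed: "x \<in> X \<Longrightarrow> free_gen K x \<in> carrier F"
  unfolding free_mem_iff by (auto simp: free_gen_def intro!: exI[of _ "{[x]}"])

end

lemma quotient_is_unital_algebra: assumes "unital_algebra K A" "ideal I A" shows "unital_algebra K (quotient_algebra A I)"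
proof -
  interpret unital_algebra K A by fact
  interpret I: ideal I A by fact
  let ?Q = "quotient_algebra A I"
  have car: "carrier ?Q = {I +>\<^bsub>A\<^esub> x | x. x \<in> carrier A}"
    by (auto simp: quotient_algebra_def FactRing_simps A_RCOSETS_def')
  have sm: "c \<odot>\<^bsub>?Q\<^esub> (I +>\<^bsub>A\<^esub> x) = I +>\<^bsub>A\<^esub> (c \<odot>\<^bsub>A\<^esub> x)" if c: "c \<in> carrier K" "x \<in> carrier A" for c x
  proof -
    have "I +>\<^bsub>A\<^esub> (c \<odot>\<^bsub>A\<^esub> y) = I +>\<^bsub>A\<^esub> (c \<odot>\<^bsub>A\<^esub> x)" if "y \<in> I +>\<^bsub>A\<^esub> x" for y
    proof -
      from that obtain i where i: "i \<in> I" "y = i \<oplus>\<^bsub>A\<^esub> x" by (auto simp: a_r_coset_def')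
      have iA: "i \<in> carrier A" using i I.a_subset by auto
      have "(c \<odot>\<^bsub>A\<^esub> \<one>\<^bsub>A\<^esub>) \<otimes>\<^bsub>A\<^esub> i \<in> I" using I.I_l_closed i c by auto
      then have "c \<odot>\<^bsub>A\<^esub> i \<in> I" using smult_mult_left c iA by simp
      then have "I +>\<^bsub>A\<^esub> (c \<odot>\<^bsub>A\<^esub> i) = I" by (rule I.a_rcos_const)
      then have "I = I +>\<^bsub>A\<^esub> (c \<odot>\<^bsub>A\<^esub> i)" ..
      then have "I +>\<^bsub>A\<^esub> (c \<odot>\<^bsub>A\<^esub> x) = I +>\<^bsub>A\<^esub> (c \<odot>\<^bsub>A\<^esub> i \<oplus>\<^bsub>A\<^esub> c \<odot>\<^bsub>A\<^esub> x)"
        using abelian_group.a_coset_add_assoc[OF A.abelian_group_axioms I.a_subset, of "c \<odot>\<^bsub>A\<^esub> i" "c \<odot>\<^bsub>A\<^esub> x"] c iA by simp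
      then show ?thesis using c iA i by (simp add: smult_r_distr)
    qed
    moreover have "x \<in> I +>\<^bsub>A\<^esub> x" using c I.a_rcos_self by blast
    ultimately have "(\<Union>y\<in>I +>\<^bsub>A\<^esub> x. I +>\<^bsub>A\<^esub> (c \<odot>\<^bsub>A\<^esub> y)) = I +>\<^bsub>A\<^esub> (c \<odot>\<^bsub>A\<^esub> x)"
      by (intro SUP_eq_const) (blast, assumption)
    then show ?thesis by (simp only: quotient_algebra_def module.select_convs)
  qed
  have R: "ring (A Quot I)" by (rule I.quotient_is_ring)
  have ad: "(I +>\<^bsub>A\<^esub> x) \<oplus>\<^bsub>?Q\<^esub> (I +>\<^bsub>A\<^esub> y) = I +>\<^bsub>A\<^esub> (x \<oplus>\<^bsub>A\<^esub> y)" if "x \<in> carrier A" "y \<in> carrier A" for x y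
    using that by (simp add: quotient_algebra_def FactRing_def I.a_rcos_sum)
  have mu: "(I +>\<^bsub>A\<^esub> x) \<otimes>\<^bsub>?Q\<^esub> (I +>\<^bsub>A\<^esub> y) = I +>\<^bsub>A\<^esub> (x \<otimes>\<^bsub>A\<^esub> y)" if "x \<in> carrier A" "y \<in> carrier A" for x y
    using that by (simp add: quotient_algebra_def FactRing_def I.rcoset_mult_add)
  have RQ: "ring ?Q"
  proof -
    interpret R: ring "A Quot I" by (rule R)
    have inv: "\<exists>y\<in>carrier (A Quot I). y \<oplus>\<^bsub>A Quot I\<^esub> x = \<zero>\<^bsub>A Quot I\<^esub>" if "x \<in> carrier (A Quot I)" for x
      by (rule bexI[of _ "\<ominus>\<^bsub>A Quot I\<^esub> x"]) (rule R.l_neg R.a_inv_closed, rule that)+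
    have e: "carrier ?Q = carrier (A Quot I)" "\<And>x y. x \<oplus>\<^bsub>?Q\<^esub> y = x \<oplus>\<^bsub>A Quot I\<^esub> y"
      "\<And>x y. x \<otimes>\<^bsub>?Q\<^esub> y = x \<otimes>\<^bsub>A Quot I\<^esub> y" "\<zero>\<^bsub>?Q\<^esub> = \<zero>\<^bsub>A Quot I\<^esub>" "\<one>\<^bsub>?Q\<^esub> = \<one>\<^bsub>A Quot I\<^esub>"
      by (simp_all add: quotient_algebra_def)
    show ?thesis
      by (intro ringI abelian_groupI monoidI)
        (unfold e, (rule R.a_closed R.zero_closed R.a_assoc R.a_comm R.l_zero R.m_closed R.one_closed
          R.m_assoc R.l_one R.r_one R.l_distr R.r_distr; assumption | (rule inv; assumption))+)
  qed
  interpret Q: ring ?Q by (rule RQ)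
  have mQ: "module K ?Q"
  proof (rule moduleI)
    show "cring K" by (rule is_cring)
    show "abelian_group ?Q" by (rule Q.abelian_group_axioms)
  qed (auto simp: car sm ad smult_l_distr smult_r_distr smult_assoc1)
  interpret M: module K ?Q by (rule mQ)
  show ?thesis by unfold_locales (auto simp: car sm mu smult_mult_left smult_mult_right)
qed

lemma par_algebra_is_unital_algebra:
  assumes "groupoid G" "field K"
  shows "unital_algebra K (par_algebra K G)"
proof -
  interpret groupoid G by fact
  interpret free_algebra_over_field K "carrier G"
    using assms by (simp add: free_algebra_over_field_def)
  interpret F: ring F by (rule free_is_ring)
  have "(\<Oplus>\<^bsub>F\<^esub>e\<in>objects G. free_gen K e) \<in> carrier F"
    by (rule F.finsum_closed) (auto simp: objects_def intro: free_gen_closed)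
  then have "par_relators K G \<subseteq> carrier F"
    unfolding par_relators_def Let_def
    by (auto intro!: F.minus_closed F.m_closed free_gen_closed ginv_closed gcomp_closed
      grng_closed gdom_closed simp: composable_def)
  then have "ideal (par_ideal K G) F"
    unfolding par_ideal_def by (rule F.genideal_ideal)
  then show ?thesis
    unfolding par_algebra_def by (rule quotient_is_unital_algebra[OF free_is_unital_algebra])
qed

end

theory Submission
  imports Defs
begin

text \<open>
  The partial groupoid algebra is a quotient of a free algebra, so the theorem splits into a formal
  part, which holds for every presentation, and one computation with groupoids.

  The formal part consists of two universal properties. A map from the variables to an algebra
  extends to exactly one homomorphism on the noncommutative polynomials (lemmas \<open>free_lift_hom\<close>,
  \<open>free_lift_gen\<close> and \<open>free_hom_ext\<close>), and a homomorphism that kills an ideal factors through the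
  quotient (lemma \<open>quotient_lift\<close>). Hence homomorphisms from the partial groupoid algebra to
  \<open>A\<close> correspond to maps from the morphisms to \<open>A\<close> that satisfy the defining relations.

  What remains is that a map satisfies these relations exactly if it is a partial representation
  (lemma \<open>partial_rep_iff_relations\<close>). The two lists of axioms share the two partial product rules
  and the decomposition of the unit. They differ in that a partial representation is asked for
  \<open>\<pi> g \<pi> (g\<inverse>) \<pi> g = \<pi> g\<close> and for orthogonality of distinct objects, while the relations ask
  for \<open>\<pi> (r g) \<pi> g = \<pi> g = \<pi> g \<pi> (d g)\<close> and for vanishing of all products of non-composable
  morphisms. Each pair of conditions gives the other by means of the product rules. In a partial
  representation, the product rules for \<open>(g, d g)\<close> and \<open>(r g, g)\<close> together with
  \<open>\<pi> g \<pi> (g\<inverse>) \<pi> g = \<pi> g\<close> allow identities to be inserted on both sides of a morphism, and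
  this reduces the vanishing of \<open>\<pi> g \<pi> h\<close> to that of \<open>\<pi> (d g) \<pi> (r h)\<close>. Conversely, distinct
  objects are not composable, and the product rule for \<open>(g, g\<inverse>)\<close> collapses
  \<open>\<pi> g \<pi> (g\<inverse>) \<pi> g\<close> to \<open>\<pi> (r g) \<pi> g\<close>.

  Both directions of the theorem then follow from one equivalence (lemma \<open>kills_ideal_iff\<close>): a
  homomorphism on the free algebra kills the ideal of relations exactly if its values on the
  generators form a partial representation.
\<close>

section \<open>Homomorphisms out of a free algebra\<close>

definition free_word :: "('k, 'n) ring_scheme \<Rightarrow> 'x list \<Rightarrow> 'x list \<Rightarrow> 'k"
  where "free_word K w = (\<lambda>v. if v = w then \<one>\<^bsub>K\<^esub> else \<zero>\<^bsub>K\<^esub>)"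

lemma free_gen_eq_word: "free_gen K x = free_word K [x]"
  by (simp add: free_gen_def free_word_def)

context free_algebra_over_field
begin

lemma one_eq_word: "\<one>\<^bsub>F\<^esub> = free_word K []"
  by (simp add: free_sel free_word_def)

lemma free_word_closed: "w \<in> lists X \<Longrightarrow> free_word K w \<in> carrier F"
  unfolding free_mem_iff free_word_def by (auto intro!: exI[of _ "{w}"])

lemma free_word_mult: "free_word K u \<otimes>\<^bsub>F\<^esub> free_word K v = free_word K (u @ v)"
proof
  fix w
  let ?f = "\<lambda>i. if length u = i then (if w = u @ v then \<one> else \<zero>) else \<zero>"
  \<comment> \<open>Only the cut of \<open>w\<close> after \<open>length u\<close> letters can contribute to the coefficient at \<open>w\<close>.\<close>
  have cut: "take i w = u \<and> drop i w = v \<longleftrightarrow> length u = i \<and> w = u @ v" if "i \<le> length w" for i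
    using that by (metis append_eq_conv_conj append_take_drop_id length_take min_absorb2)
  have "(free_word K u \<otimes>\<^bsub>F\<^esub> free_word K v) w = (\<Oplus>i\<in>{..length w}. ?f i)"
    unfolding free_sel by (rule finsum_cong') (use cut in \<open>auto simp: free_word_def\<close>)
  also have "\<dots> = free_word K (u @ v) w"
  proof (cases "length u \<le> length w")
    case True
    then show ?thesis
      using add.finprod_singleton[of "length u" "{..length w}" "\<lambda>_. if w = u @ v then \<one> else \<zero>"]
      by (simp add: free_word_def)
  next
    case False
    then have "(\<Oplus>i\<in>{..length w}. ?f i) = (\<Oplus>i\<in>{..length w}. \<zero>)"
      by (intro finsum_cong') auto
    then show ?thesis using False by (auto simp: free_word_def)
  qed
  finally show "(free_word K u \<otimes>\<^bsub>F\<^esub> free_word K v) w = free_word K (u @ v) w" .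
qed

text \<open>
  Every polynomial is a finite linear combination of words. A statement that is linear
  in the polynomial, such as the agreement of two homomorphisms, then needs to be checked on words
  only.
\<close>

lemma free_induct [consumes 1, case_names zero add]:
  assumes "p \<in> carrier F"
    and zero: "P \<zero>\<^bsub>F\<^esub>"
    and add: "\<And>c w q. \<lbrakk>c \<in> carrier K; w \<in> lists X; q \<in> carrier F; P q\<rbrakk>
      \<Longrightarrow> P (c \<odot>\<^bsub>F\<^esub> free_word K w \<oplus>\<^bsub>F\<^esub> q)"
  shows "P p"
proof -
  have "P p" if "finite S" "S \<subseteq> lists X" "p \<in> carrier F" "\<forall>w. w \<notin> S \<longrightarrow> p w = \<zero>" for S p
    using that
  proof (induction S arbitrary: p rule: finite_induct)
    case empty
    then have "p = \<zero>\<^bsub>F\<^esub>" by (auto simp: free_sel)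
    with zero show ?case by simp
  next
    case (insert w S)
    let ?q = "p(w := \<zero>)"
    have q: "?q \<in> carrier F"
      unfolding free_mem_iff using insert.prems insert.hyps
      by (auto simp: free_coeff intro!: exI[of _ S])
    have "P ?q"
    proof (rule insert.IH)
      show "?q \<in> carrier F" by (rule q)
    qed (use insert.prems in auto)
    moreover have "p = p w \<odot>\<^bsub>F\<^esub> free_word K w \<oplus>\<^bsub>F\<^esub> ?q"
      using insert.prems free_coeff[of p] by (auto simp: free_sel free_word_def)
    ultimately show ?case
      using add[of "p w" w ?q] q insert.prems free_coeff[of p w] by auto
  qed
  then show ?thesis using assms(1) free_mem_iff[of p] by blast
qed

end

definition word_eval :: "('a, 'p) ring_scheme \<Rightarrow> ('x \<Rightarrow> 'a) \<Rightarrow> 'x list \<Rightarrow> 'a"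
  where "word_eval A \<pi> w = foldr (\<lambda>x a. \<pi> x \<otimes>\<^bsub>A\<^esub> a) w \<one>\<^bsub>A\<^esub>"

definition free_lift ::
    "('k, 'n) ring_scheme \<Rightarrow> ('k, 'a, 'p) module_scheme \<Rightarrow> ('x \<Rightarrow> 'a) \<Rightarrow> ('x list \<Rightarrow> 'k) \<Rightarrow> 'a"
  where "free_lift K A \<pi> p = (\<Oplus>\<^bsub>A\<^esub>w\<in>{w. p w \<noteq> \<zero>\<^bsub>K\<^esub>}. p w \<odot>\<^bsub>A\<^esub> word_eval A \<pi> w)"

locale free_algebra_map = free_algebra_over_field K X + A: unital_algebra K A
  for K :: "('k, 'n) ring_scheme" (structure) and X :: "'x set"
    and A :: "('k, 'a, 'p) module_scheme" +
  fixes \<pi> :: "'x \<Rightarrow> 'a"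
  assumes \<pi>_closed: "\<pi> \<in> X \<rightarrow> carrier A"
begin

sublocale free: unital_algebra K F
  by (rule free_is_unital_algebra)

lemma word_eval_closed: "w \<in> lists X \<Longrightarrow> word_eval A \<pi> w \<in> carrier A"
  by (induction w) (use \<pi>_closed in \<open>auto simp: word_eval_def\<close>)

lemma word_eval_append:
  "u \<in> lists X \<Longrightarrow> v \<in> lists X \<Longrightarrow>
    word_eval A \<pi> (u @ v) = word_eval A \<pi> u \<otimes>\<^bsub>A\<^esub> word_eval A \<pi> v"
proof (induction u)
  case Nil
  then show ?case using word_eval_closed[of v] by (simp add: word_eval_def)
next
  case (Cons x u)
  then have "\<pi> x \<in> carrier A" "word_eval A \<pi> u \<in> carrier A" "word_eval A \<pi> v \<in> carrier A"
    using \<pi>_closed word_eval_closed by auto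
  with Cons show ?case by (simp add: word_eval_def A.A.m_assoc)
qed

text \<open>
  The support of a polynomial depends on the polynomial. Summation over any larger finite set of
  words gives the same value, which makes it possible to compare several polynomials termwise.
\<close>

lemma free_lift_eq_sum:
  assumes "p \<in> carrier F" "finite S" "S \<subseteq> lists X" "\<forall>w. w \<notin> S \<longrightarrow> p w = \<zero>"
  shows "free_lift K A \<pi> p = (\<Oplus>\<^bsub>A\<^esub>w\<in>S. p w \<odot>\<^bsub>A\<^esub> word_eval A \<pi> w)"
  unfolding free_lift_def
proof (rule A.A.add.finprod_mono_neutral_cong_left)
  show "{w. p w \<noteq> \<zero>} \<subseteq> S" using assms(4) by auto
  show "(\<lambda>w. p w \<odot>\<^bsub>A\<^esub> word_eval A \<pi> w) \<in> S \<rightarrow> carrier A"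
    using assms free_coeff word_eval_closed by blast
  show "p w \<odot>\<^bsub>A\<^esub> word_eval A \<pi> w = \<zero>\<^bsub>A\<^esub>" if "w \<in> S - {w. p w \<noteq> \<zero>}" for w
    using that assms(3) word_eval_closed[of w] by (auto simp: subset_iff)
qed (use assms in auto)

lemma free_lift_closed:
  assumes "p \<in> carrier F" shows "free_lift K A \<pi> p \<in> carrier A"
  unfolding free_lift_def
proof (rule A.A.finsum_closed, intro funcsetI)
  fix w assume "w \<in> {w. p w \<noteq> \<zero>}"
  then have "w \<in> lists X" using assms by (auto simp: free_algebra_def)
  then show "p w \<odot>\<^bsub>A\<^esub> word_eval A \<pi> w \<in> carrier A"
    using free_coeff[OF assms] word_eval_closed by blast
qed

lemma free_lift_add:
  assumes "p \<in> carrier F" "q \<in> carrier F"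
  shows "free_lift K A \<pi> (p \<oplus>\<^bsub>F\<^esub> q) = free_lift K A \<pi> p \<oplus>\<^bsub>A\<^esub> free_lift K A \<pi> q"
proof -
  from assms obtain S T where S: "finite S" "S \<subseteq> lists X" "\<forall>w. w \<notin> S \<longrightarrow> p w = \<zero>"
    and T: "finite T" "T \<subseteq> lists X" "\<forall>w. w \<notin> T \<longrightarrow> q w = \<zero>"
    unfolding free_mem_iff by blast
  let ?U = "S \<union> T" and ?e = "word_eval A \<pi>"
  have U: "finite ?U" "?U \<subseteq> lists X" "\<forall>w. w \<notin> ?U \<longrightarrow> p w = \<zero>"
    "\<forall>w. w \<notin> ?U \<longrightarrow> q w = \<zero>" "\<forall>w. w \<notin> ?U \<longrightarrow> (p \<oplus>\<^bsub>F\<^esub> q) w = \<zero>"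
    using S T by (auto simp: free_sel)
  have cl: "?e w \<in> carrier A" if "w \<in> ?U" for w
    using that U(2) word_eval_closed by blast
  note c = assms[THEN free_coeff]
  have "free_lift K A \<pi> (p \<oplus>\<^bsub>F\<^esub> q) = (\<Oplus>\<^bsub>A\<^esub>w\<in>?U. p w \<odot>\<^bsub>A\<^esub> ?e w \<oplus>\<^bsub>A\<^esub> q w \<odot>\<^bsub>A\<^esub> ?e w)"
    unfolding free_lift_eq_sum[OF free_add_closed[OF assms] U(1,2,5)]
    by (rule A.A.finsum_cong') (use c cl in \<open>auto simp: free_sel A.smult_l_distr\<close>)
  also have "\<dots> = free_lift K A \<pi> p \<oplus>\<^bsub>A\<^esub> free_lift K A \<pi> q"
    unfolding free_lift_eq_sum[OF assms(1) U(1-3)] free_lift_eq_sum[OF assms(2) U(1,2,4)]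
    by (rule A.A.finsum_addf) (use c cl in auto)
  finally show ?thesis .
qed

lemma free_lift_smult:
  assumes "c \<in> carrier K" "p \<in> carrier F"
  shows "free_lift K A \<pi> (c \<odot>\<^bsub>F\<^esub> p) = c \<odot>\<^bsub>A\<^esub> free_lift K A \<pi> p"
proof -
  from assms obtain S where S: "finite S" "S \<subseteq> lists X" "\<forall>w. w \<notin> S \<longrightarrow> p w = \<zero>"
    unfolding free_mem_iff by blast
  let ?e = "word_eval A \<pi>"
  have cp: "\<forall>w. w \<notin> S \<longrightarrow> (c \<odot>\<^bsub>F\<^esub> p) w = \<zero>" using S assms by (auto simp: free_sel)
  have cl: "?e w \<in> carrier A" if "w \<in> S" for w
    using that S(2) word_eval_closed by blast
  note co = free_coeff[OF assms(2)]
  have "free_lift K A \<pi> (c \<odot>\<^bsub>F\<^esub> p) = (\<Oplus>\<^bsub>A\<^esub>w\<in>S. c \<odot>\<^bsub>A\<^esub> (p w \<odot>\<^bsub>A\<^esub> ?e w))"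
    unfolding free_lift_eq_sum[OF free_smult_closed[OF assms] S(1,2) cp]
    by (rule A.A.finsum_cong') (use co cl assms in \<open>auto simp: free_sel A.smult_assoc1\<close>)
  also have "\<dots> = c \<odot>\<^bsub>A\<^esub> free_lift K A \<pi> p"
    unfolding free_lift_eq_sum[OF assms(2) S]
    by (rule A.finsum_smult_ldistr[symmetric]) (use S co cl assms in auto)
  finally show ?thesis .
qed

lemma free_lift_word:
  assumes "w \<in> lists X" shows "free_lift K A \<pi> (free_word K w) = word_eval A \<pi> w"
proof -
  have "free_lift K A \<pi> (free_word K w) = (\<Oplus>\<^bsub>A\<^esub>v\<in>{w}. free_word K w v \<odot>\<^bsub>A\<^esub> word_eval A \<pi> v)"
    by (rule free_lift_eq_sum) (use assms free_word_closed in \<open>auto simp: free_word_def\<close>)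
  then show ?thesis using word_eval_closed[OF assms] by (simp add: free_word_def)
qed

lemma free_lift_zero: "free_lift K A \<pi> \<zero>\<^bsub>F\<^esub> = \<zero>\<^bsub>A\<^esub>"
  by (simp add: free_lift_def free_sel)

text \<open>
  Both sides are bilinear, so induction over each factor in turn reduces the claim to two words,
  where it says that evaluation turns concatenation into multiplication.
\<close>

lemma free_lift_mult:
  assumes "p \<in> carrier F" "q \<in> carrier F"
  shows "free_lift K A \<pi> (p \<otimes>\<^bsub>F\<^esub> q) = free_lift K A \<pi> p \<otimes>\<^bsub>A\<^esub> free_lift K A \<pi> q"
proof -
  have word: "free_lift K A \<pi> (free_word K u \<otimes>\<^bsub>F\<^esub> q) = word_eval A \<pi> u \<otimes>\<^bsub>A\<^esub> free_lift K A \<pi> q"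
    if u: "u \<in> lists X" for u
    using assms(2)
  proof (induction q rule: free_induct)
    case zero
    then show ?case using u by (simp add: free_lift_zero free_word_closed word_eval_closed)
  next
    case (add c v q)
    then show ?case using u
      by (simp add: free.A.r_distr free.smult_mult_right free_word_mult free_word_closed
          free_lift_add free_lift_smult free_lift_word free_lift_closed word_eval_closed
          A.A.r_distr A.smult_mult_right word_eval_append)
  qed
  show ?thesis using assms(1)
  proof (induction p rule: free_induct)
    case zero
    then show ?case using assms(2) by (simp add: free_lift_zero free_lift_closed)
  next
    case (add c u p)
    then show ?case using assms(2)
      by (simp add: free.A.l_distr free.smult_mult_left word free_word_closed
          free_lift_add free_lift_smult free_lift_word free_lift_closed word_eval_closed
          A.A.l_distr A.smult_mult_left)
  qed
qed

lemma free_lift_hom: "free_lift K A \<pi> \<in> algebra_hom K F A"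
  unfolding algebra_hom_def
  by (auto intro!: ring_hom_memI
      simp: free_lift_closed free_lift_add free_lift_mult free_lift_smult one_eq_word free_lift_word)
    (simp add: word_eval_def)

lemma free_lift_gen: "x \<in> X \<Longrightarrow> free_lift K A \<pi> (free_gen K x) = \<pi> x"
  using free_lift_word[of "[x]"] funcset_mem[OF \<pi>_closed] by (simp add: free_gen_eq_word word_eval_def)

end

lemma (in free_algebra_over_field) free_hom_ext:
  assumes "unital_algebra K A"
    and f: "f \<in> algebra_hom K F A" and g: "g \<in> algebra_hom K F A"
    and gen: "\<And>x. x \<in> X \<Longrightarrow> f (free_gen K x) = g (free_gen K x)"
    and "p \<in> carrier F"
  shows "f p = g p"
proof -
  interpret A: unital_algebra K A by fact
  interpret free: unital_algebra K F by (rule free_is_unital_algebra)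
  interpret f: ring_hom_ring F A f
    using f by (simp add: algebra_hom_def ring_hom_ringI2 free.A.ring_axioms A.A.ring_axioms)
  interpret g: ring_hom_ring F A g
    using g by (simp add: algebra_hom_def ring_hom_ringI2 free.A.ring_axioms A.A.ring_axioms)
  have word: "f (free_word K w) = g (free_word K w)" if "w \<in> lists X" for w
    using that
  proof (induction w)
    case Nil
    then show ?case using f.hom_one g.hom_one by (simp add: one_eq_word)
  next
    case (Cons x w)
    have "free_word K (x # w) = free_gen K x \<otimes>\<^bsub>F\<^esub> free_word K w"
      by (simp add: free_gen_eq_word free_word_mult)
    with Cons show ?case by (simp add: gen free_gen_closed free_word_closed)
  qed
  show ?thesis using assms(5)
  proof (induction p rule: free_induct)
    case (add c w p)
    then show ?case using f g word by (simp add: algebra_hom_def free_word_closed)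
  qed simp
qed


section \<open>Homomorphisms out of a quotient algebra\<close>

lemma carrier_quotient_algebra:
  "carrier (quotient_algebra A I) = (\<lambda>x. I +>\<^bsub>A\<^esub> x) ` carrier A"
  by (auto simp: quotient_algebra_def FactRing_simps A_RCOSETS_def')

text \<open>
  The point is the scalar multiplication, defined as a union over all representatives of a coset:
  an ideal absorbs the scalar \<open>c\<close> as the element \<open>c \<odot> 1\<close>, so all representatives give the same
  coset and the union collapses to it.
\<close>

lemma quotient_proj_hom:
  assumes "unital_algebra K A" "ideal I A"
  shows "(\<lambda>x. I +>\<^bsub>A\<^esub> x) \<in> algebra_hom K A (quotient_algebra A I)"
proof -
  interpret unital_algebra K A by fact
  interpret I: ideal I A by fact
  let ?Q = "quotient_algebra A I"
  have "c \<odot>\<^bsub>?Q\<^esub> (I +>\<^bsub>A\<^esub> x) = I +>\<^bsub>A\<^esub> (c \<odot>\<^bsub>A\<^esub> x)" if c: "c \<in> carrier K" "x \<in> carrier A" for c x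
  proof -
    have "I +>\<^bsub>A\<^esub> (c \<odot>\<^bsub>A\<^esub> y) = I +>\<^bsub>A\<^esub> (c \<odot>\<^bsub>A\<^esub> x)" if "y \<in> I +>\<^bsub>A\<^esub> x" for y
    proof -
      from that have y: "y \<in> carrier A"
        using A.a_r_coset_subset_G[OF I.a_subset] c by blast
      have eq: "I +>\<^bsub>A\<^esub> y = I +>\<^bsub>A\<^esub> x" using I.a_repr_independence'[OF that] c by simp
      then have "y \<ominus>\<^bsub>A\<^esub> x \<in> I"
        using A.quotient_eq_iff_same_a_r_cos[OF I.ideal_axioms y] c by simp
      then have "(c \<odot>\<^bsub>A\<^esub> \<one>\<^bsub>A\<^esub>) \<otimes>\<^bsub>A\<^esub> (y \<ominus>\<^bsub>A\<^esub> x) \<in> I" using I.I_l_closed c by auto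
      then have "c \<odot>\<^bsub>A\<^esub> y \<ominus>\<^bsub>A\<^esub> c \<odot>\<^bsub>A\<^esub> x \<in> I"
        using c y by (simp add: smult_mult_left a_minus_def smult_r_distr smult_r_minus)
      then show ?thesis
        using A.quotient_eq_iff_same_a_r_cos[OF I.ideal_axioms] c y by simp
    qed
    moreover have "x \<in> I +>\<^bsub>A\<^esub> x" using c I.a_rcos_self by blast
    ultimately have "(\<Union>y\<in>I +>\<^bsub>A\<^esub> x. I +>\<^bsub>A\<^esub> (c \<odot>\<^bsub>A\<^esub> y)) = I +>\<^bsub>A\<^esub> (c \<odot>\<^bsub>A\<^esub> x)"
      by (intro SUP_eq_const) (blast, assumption)
    then show ?thesis by (simp only: quotient_algebra_def module.select_convs)
  qed
  moreover have "(\<lambda>x. I +>\<^bsub>A\<^esub> x) \<in> ring_hom A ?Q"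
    using I.rcos_ring_hom by (simp add: ring_hom_def quotient_algebra_def)
  ultimately show ?thesis by (simp add: algebra_hom_def)
qed

lemma algebra_hom_comp:
  "f \<in> algebra_hom K A B \<Longrightarrow> g \<in> algebra_hom K B C \<Longrightarrow> g \<circ> f \<in> algebra_hom K A C"
  by (auto simp: algebra_hom_def ring_hom_def Pi_def)

lemma quotient_lift:
  assumes A: "unital_algebra K A" and I: "ideal I A" and B: "unital_algebra K B"
    and f: "f \<in> algebra_hom K A B" and kill: "\<And>x. x \<in> I \<Longrightarrow> f x = \<zero>\<^bsub>B\<^esub>"
  obtains \<phi> where "\<phi> \<in> algebra_hom K (quotient_algebra A I) B"
    "\<phi> \<in> extensional (carrier (quotient_algebra A I))"
    "\<forall>x\<in>carrier A. \<phi> (I +>\<^bsub>A\<^esub> x) = f x"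
proof -
  interpret A: unital_algebra K A by (rule A)
  interpret B: unital_algebra K B by (rule B)
  interpret I: ideal I A by (rule I)
  let ?Q = "quotient_algebra A I" and ?p = "\<lambda>x. I +>\<^bsub>A\<^esub> x"
  interpret Q: unital_algebra K ?Q by (rule quotient_is_unital_algebra[OF A I])
  have p: "?p \<in> algebra_hom K A ?Q" by (rule quotient_proj_hom[OF A I])
  interpret f: ring_hom_ring A B f
    using f by (simp add: algebra_hom_def ring_hom_ringI2 A.A.ring_axioms B.A.ring_axioms)
  have indep: "f x = f y" if "x \<in> carrier A" "y \<in> carrier A" "?p x = ?p y" for x y
  proof -
    have "f (x \<ominus>\<^bsub>A\<^esub> y) = \<zero>\<^bsub>B\<^esub>"
      using kill A.A.quotient_eq_iff_same_a_r_cos[OF I] that by blast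
    then show ?thesis using that by (simp add: a_minus_def B.A.add.inv_solve_right' )
  qed
  define \<phi> where "\<phi> = (\<lambda>S\<in>carrier ?Q. f (SOME x. x \<in> carrier A \<and> ?p x = S))"
  have \<phi>: "\<phi> (?p x) = f x" if "x \<in> carrier A" for x
  proof -
    have "\<exists>y. y \<in> carrier A \<and> ?p y = ?p x" using that by blast
    from someI_ex[OF this] have "f (SOME y. y \<in> carrier A \<and> ?p y = ?p x) = f x"
      using indep that by blast
    then show ?thesis using that by (simp add: \<phi>_def carrier_quotient_algebra)
  qed
  have "\<phi> \<in> algebra_hom K ?Q B"
    unfolding algebra_hom_def
  proof (intro CollectI conjI ballI ring_hom_memI)
    fix S assume "S \<in> carrier ?Q"
    then obtain x where x: "x \<in> carrier A" "S = ?p x" by (auto simp: carrier_quotient_algebra)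
    show "\<phi> S \<in> carrier B" using x by (simp add: \<phi>)
    { fix c assume c: "c \<in> carrier K"
      have "c \<odot>\<^bsub>?Q\<^esub> S = ?p (c \<odot>\<^bsub>A\<^esub> x)" using p c x by (simp add: algebra_hom_def)
      then show "\<phi> (c \<odot>\<^bsub>?Q\<^esub> S) = c \<odot>\<^bsub>B\<^esub> \<phi> S" using c x f by (simp add: \<phi> algebra_hom_def) }
    fix T assume "T \<in> carrier ?Q"
    then obtain y where y: "y \<in> carrier A" "T = ?p y" by (auto simp: carrier_quotient_algebra)
    have "S \<otimes>\<^bsub>?Q\<^esub> T = ?p (x \<otimes>\<^bsub>A\<^esub> y)" "S \<oplus>\<^bsub>?Q\<^esub> T = ?p (x \<oplus>\<^bsub>A\<^esub> y)"
      using p x y by (auto simp: algebra_hom_def ring_hom_def)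
    then show "\<phi> (S \<otimes>\<^bsub>?Q\<^esub> T) = \<phi> S \<otimes>\<^bsub>B\<^esub> \<phi> T" "\<phi> (S \<oplus>\<^bsub>?Q\<^esub> T) = \<phi> S \<oplus>\<^bsub>B\<^esub> \<phi> T"
      using x y by (simp_all add: \<phi>)
  next
    have "\<one>\<^bsub>?Q\<^esub> = ?p \<one>\<^bsub>A\<^esub>" using p by (simp add: algebra_hom_def ring_hom_def)
    then show "\<phi> \<one>\<^bsub>?Q\<^esub> = \<one>\<^bsub>B\<^esub>" by (simp add: \<phi>)
  qed
  moreover have "\<phi> \<in> extensional (carrier ?Q)" by (simp add: \<phi>_def)
  ultimately show ?thesis using \<phi> that by blast
qed


section \<open>Partial representations and the relations of the partial groupoid algebra\<close>

text \<open>
  The defining relations of the partial groupoid algebra, imposed on the values of a map into an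
  arbitrary ring instead of on the free generators.
\<close>

definition par_relations :: "('g, 'm) arrows_scheme \<Rightarrow> ('a, 'p) ring_scheme \<Rightarrow> ('g \<Rightarrow> 'a) \<Rightarrow> bool"
  where "par_relations G A \<pi> \<longleftrightarrow>
    (\<forall>g h. (g, h) \<in> composable G \<longrightarrow>
      \<pi> (ginv G g) \<otimes>\<^bsub>A\<^esub> \<pi> g \<otimes>\<^bsub>A\<^esub> \<pi> h = \<pi> (ginv G g) \<otimes>\<^bsub>A\<^esub> \<pi> (gcomp G g h)) \<and>
    (\<forall>g h. (g, h) \<in> composable G \<longrightarrow>
      \<pi> g \<otimes>\<^bsub>A\<^esub> \<pi> h \<otimes>\<^bsub>A\<^esub> \<pi> (ginv G h) = \<pi> (gcomp G g h) \<otimes>\<^bsub>A\<^esub> \<pi> (ginv G h)) \<and>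
    (\<forall>g \<in> carrier G. \<pi> (grng G g) \<otimes>\<^bsub>A\<^esub> \<pi> g = \<pi> g) \<and>
    (\<forall>g \<in> carrier G. \<pi> g \<otimes>\<^bsub>A\<^esub> \<pi> (gdom G g) = \<pi> g) \<and>
    (\<forall>g h. (g, h) \<in> carrier G \<times> carrier G - composable G \<longrightarrow> \<pi> g \<otimes>\<^bsub>A\<^esub> \<pi> h = \<zero>\<^bsub>A\<^esub>) \<and>
    (\<Oplus>\<^bsub>A\<^esub>e\<in>objects G. \<pi> e) = \<one>\<^bsub>A\<^esub>"

context groupoid
begin

lemma ginv_ginv: "g \<in> carrier G \<Longrightarrow> ginv G (ginv G g) = g"
proof -
  assume g: "g \<in> carrier G"
  have "is_ginv G (ginv G g) g"
    using is_ginv_ginv[OF g] by (auto simp: is_ginv_def composable_def)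
  then show ?thesis using is_ginv_unique is_ginv_ginv ginv_closed g by blast
qed

lemma partial_rep_iff_relations:
  assumes "ring A" and \<pi>: "\<pi> \<in> carrier G \<rightarrow> carrier A"
  shows "partial_rep G A \<pi> \<longleftrightarrow> par_relations G A \<pi>"
proof -
  interpret ring A by fact
  note cl = funcset_mem[OF \<pi>] ginv_closed gdom_closed grng_closed
  show ?thesis
  proof
    assume P: "partial_rep G A \<pi>"
    have right: "\<pi> g \<otimes>\<^bsub>A\<^esub> \<pi> (gdom G g) = \<pi> g" if g: "g \<in> carrier G" for g
    proof -
      have comp: "(g, gdom G g) \<in> composable G"
        using g by (simp add: composable_def gdom_closed grng_gdom)
      have "\<pi> g \<otimes>\<^bsub>A\<^esub> \<pi> (gdom G g) = \<pi> g \<otimes>\<^bsub>A\<^esub> (\<pi> (ginv G g) \<otimes>\<^bsub>A\<^esub> \<pi> g \<otimes>\<^bsub>A\<^esub> \<pi> (gdom G g))"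
        using P g by (simp add: partial_rep_def m_assoc[symmetric] cl)
      also have "\<dots> = \<pi> g \<otimes>\<^bsub>A\<^esub> (\<pi> (ginv G g) \<otimes>\<^bsub>A\<^esub> \<pi> g)"
        using P comp g by (auto simp: partial_rep_def gcomp_gdom)
      also have "\<dots> = \<pi> g"
        using P g by (simp add: partial_rep_def m_assoc[symmetric] cl)
      finally show ?thesis .
    qed
    have left: "\<pi> (grng G g) \<otimes>\<^bsub>A\<^esub> \<pi> g = \<pi> g" if g: "g \<in> carrier G" for g
    proof -
      have comp: "(grng G g, g) \<in> composable G"
        using g by (simp add: composable_def grng_closed gdom_grng)
      have "\<pi> (grng G g) \<otimes>\<^bsub>A\<^esub> \<pi> g = \<pi> (grng G g) \<otimes>\<^bsub>A\<^esub> (\<pi> g \<otimes>\<^bsub>A\<^esub> \<pi> (ginv G g) \<otimes>\<^bsub>A\<^esub> \<pi> g)"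
        using P g by (simp add: partial_rep_def)
      also have "\<dots> = \<pi> (grng G g) \<otimes>\<^bsub>A\<^esub> \<pi> g \<otimes>\<^bsub>A\<^esub> \<pi> (ginv G g) \<otimes>\<^bsub>A\<^esub> \<pi> g"
        using g by (simp add: m_assoc cl)
      also have "\<dots> = \<pi> g \<otimes>\<^bsub>A\<^esub> \<pi> (ginv G g) \<otimes>\<^bsub>A\<^esub> \<pi> g"
        using P comp g by (auto simp: partial_rep_def grng_gcomp_self)
      also have "\<dots> = \<pi> g"
        using P g by (simp add: partial_rep_def)
      finally show ?thesis .
    qed
    have orth: "\<pi> g \<otimes>\<^bsub>A\<^esub> \<pi> h = \<zero>\<^bsub>A\<^esub>"
      if gh: "g \<in> carrier G" "h \<in> carrier G" "(g, h) \<notin> composable G" for g h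
    proof -
      have "\<pi> (gdom G g) \<otimes>\<^bsub>A\<^esub> \<pi> (grng G h) = \<zero>\<^bsub>A\<^esub>"
        using P gh by (simp add: partial_rep_def composable_def objects_def gdom_gdom gdom_grng cl)
      moreover have "\<pi> g \<otimes>\<^bsub>A\<^esub> \<pi> h = (\<pi> g \<otimes>\<^bsub>A\<^esub> \<pi> (gdom G g)) \<otimes>\<^bsub>A\<^esub> (\<pi> (grng G h) \<otimes>\<^bsub>A\<^esub> \<pi> h)"
        using gh by (simp add: left right)
      moreover have "\<dots> = \<pi> g \<otimes>\<^bsub>A\<^esub> (\<pi> (gdom G g) \<otimes>\<^bsub>A\<^esub> \<pi> (grng G h)) \<otimes>\<^bsub>A\<^esub> \<pi> h"
        using gh by (simp add: m_assoc cl)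
      ultimately show ?thesis using gh by (simp add: cl)
    qed
    show "par_relations G A \<pi>"
      using P left right orth unfolding par_relations_def partial_rep_def by auto
  next
    assume R: "par_relations G A \<pi>"
    have "\<pi> g \<otimes>\<^bsub>A\<^esub> \<pi> (ginv G g) \<otimes>\<^bsub>A\<^esub> \<pi> g = \<pi> g" if g: "g \<in> carrier G" for g
    proof -
      have "(g, ginv G g) \<in> composable G" using is_ginv_ginv[OF g] by (simp add: is_ginv_def)
      then have "\<pi> g \<otimes>\<^bsub>A\<^esub> \<pi> (ginv G g) \<otimes>\<^bsub>A\<^esub> \<pi> (ginv G (ginv G g))
          = \<pi> (gcomp G g (ginv G g)) \<otimes>\<^bsub>A\<^esub> \<pi> (ginv G (ginv G g))"
        using R by (auto simp: par_relations_def)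
      then show ?thesis
        using R g by (simp add: par_relations_def ginv_ginv grng_eq[symmetric])
    qed
    moreover have "(e, f) \<in> carrier G \<times> carrier G - composable G"
      if "e \<in> objects G" "f \<in> objects G" "e \<noteq> f" for e f
      using that grng_gdom[of f] by (auto simp: objects_def composable_def)
    ultimately show "partial_rep G A \<pi>"
      using R \<pi> unfolding par_relations_def partial_rep_def by auto
  qed
qed

lemma partial_rep_cong:
  assumes "ring A" and \<pi>: "partial_rep G A \<pi>" and eq: "\<And>g. g \<in> carrier G \<Longrightarrow> \<pi>' g = \<pi> g"
  shows "partial_rep G A \<pi>'"
proof -
  interpret ring A by fact
  have "\<pi> \<in> carrier G \<rightarrow> carrier A" using \<pi> by (simp add: partial_rep_def)
  then have "(\<Oplus>\<^bsub>A\<^esub>e\<in>objects G. \<pi>' e) = (\<Oplus>\<^bsub>A\<^esub>e\<in>objects G. \<pi> e)"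
    by (intro finsum_cong') (auto simp: objects_def eq)
  moreover have "g \<in> carrier G" "h \<in> carrier G" if "(g, h) \<in> composable G" for g h
    using that by (auto simp: composable_def)
  ultimately show ?thesis
    using \<pi> by (auto simp: partial_rep_def eq ginv_closed gcomp_closed objects_def)
qed

lemma par_relators_subset:
  assumes "field K"
  shows "par_relators K G \<subseteq> carrier (free_algebra K (carrier G))"
proof -
  interpret free_algebra_over_field K "carrier G"
    using assms by (simp add: free_algebra_over_field_def)
  interpret F: ring F by (rule free_is_ring)
  have "(\<Oplus>\<^bsub>F\<^esub>e\<in>objects G. free_gen K e) \<in> carrier F"
    by (rule F.finsum_closed) (auto simp: objects_def intro: free_gen_closed)
  then show ?thesis
    unfolding par_relators_def Let_def
    by (auto intro!: F.minus_closed F.m_closed free_gen_closed ginv_closed gcomp_closed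
      grng_closed gdom_closed simp: composable_def)
qed

lemma kills_relators_iff:
  assumes "field K" "finite (carrier G)" "ring A"
    and f: "f \<in> ring_hom (free_algebra K (carrier G)) A"
  shows "(\<forall>r\<in>par_relators K G. f r = \<zero>\<^bsub>A\<^esub>) \<longleftrightarrow> par_relations G A (\<lambda>g. f (free_gen K g))"
proof -
  interpret free_algebra_over_field K "carrier G"
    using assms by (simp add: free_algebra_over_field_def)
  interpret F: ring F by (rule free_is_ring)
  interpret A: ring A by fact
  interpret f: ring_hom_ring F A f by (rule ring_hom_ringI2) (fact free_is_ring assms)+
  let ?x = "free_gen K"
  have minus: "f (a \<ominus>\<^bsub>F\<^esub> b) = \<zero>\<^bsub>A\<^esub> \<longleftrightarrow> f a = f b" if "a \<in> carrier F" "b \<in> carrier F" for a b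
    using that by (auto simp: a_minus_def A.r_neg dest: A.minus_equality)
  have fin: "finite (objects G)" using assms(2) by (simp add: objects_def)
  have obj: "e \<in> objects G \<Longrightarrow> e \<in> carrier G" for e by (simp add: objects_def)
  have "f (\<Oplus>\<^bsub>F\<^esub>e\<in>E. free_gen K e) = (\<Oplus>\<^bsub>A\<^esub>e\<in>E. f (free_gen K e))"
    if "finite E" "E \<subseteq> carrier G" for E
    using that
  proof (induction E rule: finite_induct)
    case (insert e E)
    then have "free_gen K \<in> E \<rightarrow> carrier F" "(\<lambda>e. f (free_gen K e)) \<in> E \<rightarrow> carrier A"
      "free_gen K e \<in> carrier F"
      by (auto intro: free_gen_closed f.hom_closed)
    with insert show ?case by simp
  qed simp
  then have sum: "f (\<Oplus>\<^bsub>F\<^esub>e\<in>objects G. free_gen K e) = (\<Oplus>\<^bsub>A\<^esub>e\<in>objects G. f (free_gen K e))"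
    using fin obj by blast
  have sumcl: "(\<Oplus>\<^bsub>F\<^esub>e\<in>objects G. free_gen K e) \<in> carrier F"
    by (rule F.finsum_closed) (auto dest: obj intro: free_gen_closed)
  note cl = free_gen_closed ginv_closed gdom_closed grng_closed gcomp_closed
  have comp: "g \<in> carrier G" "h \<in> carrier G" if "(g, h) \<in> composable G" for g h
    using that by (auto simp: composable_def)
  \<comment> \<open>Quantification over an indexed family of relators is quantification over the indices.\<close>
  have family1: "(\<forall>r\<in>{t g | g. P g}. Q r) \<longleftrightarrow> (\<forall>g. P g \<longrightarrow> Q (t g))"
    for t :: "'a \<Rightarrow> 'a list \<Rightarrow> 'c" and P Q by blast
  have family2: "(\<forall>r\<in>{t g h | g h. P g h}. Q r) \<longleftrightarrow> (\<forall>g h. P g h \<longrightarrow> Q (t g h))"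
    for t :: "'a \<Rightarrow> 'a \<Rightarrow> 'a list \<Rightarrow> 'c" and P Q by blast
  have "(\<forall>r\<in>par_relators K G. f r = \<zero>\<^bsub>A\<^esub>) \<longleftrightarrow>
    (\<forall>g h. (g, h) \<in> composable G \<longrightarrow>
      f (?x (ginv G g) \<otimes>\<^bsub>F\<^esub> ?x g \<otimes>\<^bsub>F\<^esub> ?x h \<ominus>\<^bsub>F\<^esub> ?x (ginv G g) \<otimes>\<^bsub>F\<^esub> ?x (gcomp G g h)) = \<zero>\<^bsub>A\<^esub>) \<and>
    (\<forall>g h. (g, h) \<in> composable G \<longrightarrow>
      f (?x g \<otimes>\<^bsub>F\<^esub> ?x h \<otimes>\<^bsub>F\<^esub> ?x (ginv G h) \<ominus>\<^bsub>F\<^esub> ?x (gcomp G g h) \<otimes>\<^bsub>F\<^esub> ?x (ginv G h)) = \<zero>\<^bsub>A\<^esub>) \<and>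
    (\<forall>g. g \<in> carrier G \<longrightarrow> f (?x (grng G g) \<otimes>\<^bsub>F\<^esub> ?x g \<ominus>\<^bsub>F\<^esub> ?x g) = \<zero>\<^bsub>A\<^esub>) \<and>
    (\<forall>g. g \<in> carrier G \<longrightarrow> f (?x g \<otimes>\<^bsub>F\<^esub> ?x (gdom G g) \<ominus>\<^bsub>F\<^esub> ?x g) = \<zero>\<^bsub>A\<^esub>) \<and>
    (\<forall>g h. (g, h) \<in> carrier G \<times> carrier G - composable G \<longrightarrow> f (?x g \<otimes>\<^bsub>F\<^esub> ?x h) = \<zero>\<^bsub>A\<^esub>) \<and>
    f ((\<Oplus>\<^bsub>F\<^esub>e\<in>objects G. ?x e) \<ominus>\<^bsub>F\<^esub> \<one>\<^bsub>F\<^esub>) = \<zero>\<^bsub>A\<^esub>"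
    unfolding par_relators_def Let_def ball_Un family1 family2
    by (simp only: ball_simps simp_thms conj_assoc)
  also have "\<dots> \<longleftrightarrow> par_relations G A (\<lambda>g. f (?x g))"
    \<comment> \<open>The congruence rule makes membership of the indices available for the closure conditions.\<close>
    by (simp add: par_relations_def Ball_def minus cl comp sum sumcl cong: imp_cong)
  finally show ?thesis .
qed

lemma par_ideal_ideal:
  assumes "field K"
  shows "ideal (par_ideal K G) (free_algebra K (carrier G))"
proof -
  interpret free_algebra_over_field K "carrier G"
    using assms by (simp add: free_algebra_over_field_def)
  show ?thesis
    unfolding par_ideal_def
    by (rule ring.genideal_ideal[OF free_is_ring par_relators_subset[OF assms]])
qed

text \<open>
  The kernel of a homomorphism is an ideal, so it contains the ideal of relations as soon as it
  contains the relators, and killing a relator \<open>a - b\<close> means \<open>f a = f b\<close>.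
\<close>

lemma kills_ideal_iff:
  assumes "field K" "finite (carrier G)" "ring A"
    and f: "f \<in> ring_hom (free_algebra K (carrier G)) A"
  shows "(\<forall>r\<in>par_ideal K G. f r = \<zero>\<^bsub>A\<^esub>) \<longleftrightarrow> partial_rep G A (\<lambda>g. f (free_gen K g))"
proof -
  interpret free_algebra_over_field K "carrier G"
    using assms by (simp add: free_algebra_over_field_def)
  interpret F: ring F by (rule free_is_ring)
  interpret f: ring_hom_ring F A f by (rule ring_hom_ringI2) (fact free_is_ring assms)+
  note sub = par_relators_subset[OF assms(1)]
  have "(\<forall>r\<in>par_ideal K G. f r = \<zero>\<^bsub>A\<^esub>) \<longleftrightarrow> (\<forall>r\<in>par_relators K G. f r = \<zero>\<^bsub>A\<^esub>)"
  proof
    assume "\<forall>r\<in>par_relators K G. f r = \<zero>\<^bsub>A\<^esub>"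
    then have "par_relators K G \<subseteq> a_kernel F A f"
      using sub unfolding a_kernel_def' by blast
    then have "par_ideal K G \<subseteq> a_kernel F A f"
      unfolding par_ideal_def by (rule F.genideal_minimal[OF f.kernel_is_ideal])
    then show "\<forall>r\<in>par_ideal K G. f r = \<zero>\<^bsub>A\<^esub>"
      using f.kernel_zero by blast
  next
    assume "\<forall>r\<in>par_ideal K G. f r = \<zero>\<^bsub>A\<^esub>"
    then show "\<forall>r\<in>par_relators K G. f r = \<zero>\<^bsub>A\<^esub>"
      using F.genideal_self[OF sub] unfolding par_ideal_def by blast
  qed
  also have "\<dots> \<longleftrightarrow> partial_rep G A (\<lambda>g. f (free_gen K g))"
    unfolding kills_relators_iff[OF assms]
    by (rule partial_rep_iff_relations[symmetric]) (use assms free_gen_closed in auto)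
  finally show ?thesis .
qed

end

section \<open>The universal property of the partial groupoid algebra\<close>

theorem theorem2p6:
  fixes G :: "('g, 'm) arrows_scheme"
    and K :: "('k, 'n) ring_scheme"
    and A :: "('k, 'a, 'p) module_scheme"
  assumes "groupoid G" and "finite (carrier G)"
    and "field K" and "unital_algebra K A"
  shows "(\<forall>\<pi>. partial_rep G A \<pi> \<longrightarrow>
            (\<exists>!\<phi>. \<phi> \<in> algebra_hom K (par_algebra K G) A \<and>
                  \<phi> \<in> extensional (carrier (par_algebra K G)) \<and>
                  (\<forall>g\<in>carrier G. \<phi> (par_gen K G g) = \<pi> g))) \<and>
         (\<forall>\<phi>. \<phi> \<in> algebra_hom K (par_algebra K G) A \<longrightarrow>
            partial_rep G A (\<lambda>g. \<phi> (par_gen K G g)))"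
proof -
  interpret G: groupoid G by fact
  interpret A: unital_algebra K A by fact
  interpret free_algebra_over_field K "carrier G"
    using assms by (simp add: free_algebra_over_field_def)
  let ?I = "par_ideal K G" and ?P = "par_algebra K G"
  note I = G.par_ideal_ideal[OF assms(3)]
  interpret I: ideal ?I F by (rule I)
  have proj: "(\<lambda>x. ?I +>\<^bsub>F\<^esub> x) \<in> algebra_hom K F ?P"
    unfolding par_algebra_def by (rule quotient_proj_hom[OF free_is_unital_algebra I])
  have P: "unital_algebra K ?P" by (rule par_algebra_is_unital_algebra) fact+
  interpret P: unital_algebra K ?P by (rule P)
  have kills: "(\<forall>r\<in>?I. f r = \<zero>\<^bsub>A\<^esub>) \<longleftrightarrow> partial_rep G A (\<lambda>g. f (free_gen K g))"
    if "f \<in> algebra_hom K F A" for f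
    by (rule G.kills_ideal_iff) (use that assms A.A.ring_axioms in \<open>auto simp: algebra_hom_def\<close>)
  show ?thesis
  proof (intro conjI allI impI)
    fix \<phi> assume \<phi>: "\<phi> \<in> algebra_hom K ?P A"
    define f where "f = \<phi> \<circ> (\<lambda>x. ?I +>\<^bsub>F\<^esub> x)"
    have f: "f \<in> algebra_hom K F A" unfolding f_def by (rule algebra_hom_comp[OF proj \<phi>])
    have "f r = \<zero>\<^bsub>A\<^esub>" if "r \<in> ?I" for r
    proof -
      have "?I +>\<^bsub>F\<^esub> r = \<zero>\<^bsub>?P\<^esub>"
        using I.a_rcos_const[OF that] by (simp add: par_algebra_def quotient_algebra_def FactRing_def)
      moreover have "\<phi> \<zero>\<^bsub>?P\<^esub> = \<zero>\<^bsub>A\<^esub>"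
        using \<phi> by (intro ring_hom_zero P.A.ring_axioms A.A.ring_axioms) (simp add: algebra_hom_def)
      ultimately show ?thesis by (simp add: f_def)
    qed
    then show "partial_rep G A (\<lambda>g. \<phi> (par_gen K G g))"
      using kills[OF f] by (simp add: f_def par_gen_def)
  next
    fix \<pi> assume \<pi>: "partial_rep G A \<pi>"
    interpret \<pi>: free_algebra_map K "carrier G" A \<pi>
      by unfold_locales (use \<pi> in \<open>simp add: partial_rep_def\<close>)
    let ?f = "free_lift K A \<pi>"
    have eq: "?f (free_gen K g) = \<pi> g" if "g \<in> carrier G" for g
      using that by (rule \<pi>.free_lift_gen)
    have "partial_rep G A (\<lambda>g. ?f (free_gen K g))"
      by (rule G.partial_rep_cong[OF A.A.ring_axioms \<pi>]) (rule eq)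
    then have kill: "?f r = \<zero>\<^bsub>A\<^esub>" if "r \<in> ?I" for r
      using that kills[OF \<pi>.free_lift_hom] by blast
    obtain \<phi> where \<phi>: "\<phi> \<in> algebra_hom K ?P A" "\<phi> \<in> extensional (carrier ?P)"
      "\<forall>x\<in>carrier F. \<phi> (?I +>\<^bsub>F\<^esub> x) = ?f x"
      by (rule quotient_lift[OF free_is_unital_algebra I assms(4) \<pi>.free_lift_hom kill,
            folded par_algebra_def])
    show "\<exists>!\<phi>. \<phi> \<in> algebra_hom K ?P A \<and> \<phi> \<in> extensional (carrier ?P) \<and>
      (\<forall>g\<in>carrier G. \<phi> (par_gen K G g) = \<pi> g)"
    proof (intro ex1I[of _ \<phi>] conjI ballI)
      show "\<phi> (par_gen K G g) = \<pi> g" if "g \<in> carrier G" for g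
        using that \<phi>(3) by (simp add: par_gen_def eq free_gen_closed)
    next
      fix \<psi> assume \<psi>: "\<psi> \<in> algebra_hom K ?P A \<and> \<psi> \<in> extensional (carrier ?P) \<and>
        (\<forall>g\<in>carrier G. \<psi> (par_gen K G g) = \<pi> g)"
      show "\<psi> = \<phi>"
      proof (rule extensionalityI)
        fix S assume "S \<in> carrier ?P"
        then obtain p where p: "p \<in> carrier F" "S = ?I +>\<^bsub>F\<^esub> p"
          unfolding par_algebra_def carrier_quotient_algebra by blast
        have "(\<psi> \<circ> (\<lambda>x. ?I +>\<^bsub>F\<^esub> x)) p = ?f p"
          by (rule free_hom_ext[OF assms(4) algebra_hom_comp[OF proj] \<pi>.free_lift_hom])
            (use \<psi> p eq in \<open>auto simp: par_gen_def\<close>)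
        then show "\<psi> S = \<phi> S" using p \<phi>(3) by simp
      qed (use \<phi> \<psi> in auto)
    qed (use \<phi> in auto)
  qed
qed

end
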